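(* Let $\mathbf{k}$ be a commutative ring with unit. The unitary $(\backslash,\vee)$-algebra $(H_{\rm LR}^{\epsilon},\backslash,|,\vee)$ of planar binary trees is the free unitary $(\backslash,\vee)$-algebra on the empty set; that is, for every unitary $(\backslash,\vee)$-algebra $(H,\backslash_H,1_H,\vee_H)$ there exists a unique morphism of unitary $(\backslash,\vee)$-algebras $H_{\rm LR}^{\epsilon}\to H$.
   Context: All modules, algebras, tensor products and linear maps are over $\mathbf{k}$. Planar binary trees: a planar binary tree is a finite rooted planar tree in which every internal vertex has exactly two ordered incoming branches (left and right). The trivial tree, with no internal vertices, is denoted $|$. Let $\mathcal{Y}$ be the set of planar binary trees and $H_{\rm LR}^{\epsilon}:=\mathbf{k}\mathcal{Y}$ the free $\mathbf{k}$-module on it. Grafting: for $T_l,T_r\in\mathcal{Y}$, $T_l\vee T_r$ is the tree obtained by creating a new root with left branch $T_l$ and right branch $T_r$; $\vee$ is extended bilinearly. Every $T\in\mathcal{Y}$ with $T\neq |$ is uniquely of the form $T=T_l\vee T_r$. Under product: the bilinear map $\backslash$ on $H_{\rm LR}^{\epsilon}$ where, for trees $S,T$, $S\backslash T$ is obtained by adjoining the root of $T$ to the rightmost branch of $S$; recursively, $|\backslash T=T$ and $(S_l\vee S_r)\backslash T=S_l\vee(S_r\backslash T)$. The unit is $|$. A unitary $(\backslash,\vee)$-algebra is a unitary associative algebra $(H,\backslash_H,1_H)$ together with a bilinear map $\vee_H:H\otimes H\to H$ such that $(x\vee_H y)\backslash_H z=x\vee_H(y\backslash_H z)$ for all $x,y,z\in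 H$. A morphism of unitary $(\backslash,\vee)$-algebras is a linear map preserving the product $\backslash$, the unit, and the operation $\vee$. *)

theory Defs
  imports "HOL-Algebra.Module" "HOL-Library.FuncSet"
begin

datatype pbtree = Triv | Graft pbtree pbtree

fun tree_under :: "pbtree \<Rightarrow> pbtree \<Rightarrow> pbtree" where
  "tree_under Triv T = T"
| "tree_under (Graft Sl Sr) T = Graft Sl (tree_under Sr T)"

text \<open>
  The product \<open>\<otimes>\<close> and the unit \<open>\<one>\<close>, inherited from the ring record, play the roles of the
  associative product (written as a backslash in the literature) and of its unit.
  \<open>smult\<close> and \<open>vee\<close> are only meaningful on the carriers.
\<close>

record ('a, 'b) under_vee = "('a, 'b) module" +
  vee :: "'b \<Rightarrow> 'b \<Rightarrow> 'b" (infixl \<open>\<curlyvee>\<index>\<close> 70)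

text \<open>
  \<open>ring H\<close> supplies associativity, the two-sided unit and biadditivity of \<open>\<otimes>\<close> (commutativity is
  not required, and \<open>\<one> = \<zero>\<close> is allowed); compatibility with scalars makes \<open>\<otimes>\<close> bilinear.
\<close>

locale unitary_under_vee_algebra = module R H + ring H
  for R :: "('a, 'm) ring_scheme" (structure)
    and H :: "('a, 'b, 'n) under_vee_scheme" (structure) +
  assumes mult_smult_left:
      "\<lbrakk> a \<in> carrier R; x \<in> carrier H; y \<in> carrier H \<rbrakk> \<Longrightarrow>
        (a \<odot>\<^bsub>H\<^esub> x) \<otimes>\<^bsub>H\<^esub> y = a \<odot>\<^bsub>H\<^esub> (x \<otimes>\<^bsub>H\<^esub> y)"
    and mult_smult_right:
      "\<lbrakk> a \<in> carrier R; x \<in> carrier H; y \<in> carrier H \<rbrakk> \<Longrightarrow>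
        x \<otimes>\<^bsub>H\<^esub> (a \<odot>\<^bsub>H\<^esub> y) = a \<odot>\<^bsub>H\<^esub> (x \<otimes>\<^bsub>H\<^esub> y)"
    and vee_closed:
      "\<lbrakk> x \<in> carrier H; y \<in> carrier H \<rbrakk> \<Longrightarrow> x \<curlyvee>\<^bsub>H\<^esub> y \<in> carrier H"
    and vee_add_left:
      "\<lbrakk> x \<in> carrier H; y \<in> carrier H; z \<in> carrier H \<rbrakk> \<Longrightarrow>
        (x \<oplus>\<^bsub>H\<^esub> y) \<curlyvee>\<^bsub>H\<^esub> z = (x \<curlyvee>\<^bsub>H\<^esub> z) \<oplus>\<^bsub>H\<^esub> (y \<curlyvee>\<^bsub>H\<^esub> z)"
    and vee_add_right:
      "\<lbrakk> x \<in> carrier H; y \<in> carrier H; z \<in> carrier H \<rbrakk> \<Longrightarrow>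
        x \<curlyvee>\<^bsub>H\<^esub> (y \<oplus>\<^bsub>H\<^esub> z) = (x \<curlyvee>\<^bsub>H\<^esub> y) \<oplus>\<^bsub>H\<^esub> (x \<curlyvee>\<^bsub>H\<^esub> z)"
    and vee_smult_left:
      "\<lbrakk> a \<in> carrier R; x \<in> carrier H; y \<in> carrier H \<rbrakk> \<Longrightarrow>
        (a \<odot>\<^bsub>H\<^esub> x) \<curlyvee>\<^bsub>H\<^esub> y = a \<odot>\<^bsub>H\<^esub> (x \<curlyvee>\<^bsub>H\<^esub> y)"
    and vee_smult_right:
      "\<lbrakk> a \<in> carrier R; x \<in> carrier H; y \<in> carrier H \<rbrakk> \<Longrightarrow>
        x \<curlyvee>\<^bsub>H\<^esub> (a \<odot>\<^bsub>H\<^esub> y) = a \<odot>\<^bsub>H\<^esub> (x \<curlyvee>\<^bsub>H\<^esub> y)"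
    and vee_mult:
      "\<lbrakk> x \<in> carrier H; y \<in> carrier H; z \<in> carrier H \<rbrakk> \<Longrightarrow>
        (x \<curlyvee>\<^bsub>H\<^esub> y) \<otimes>\<^bsub>H\<^esub> z = x \<curlyvee>\<^bsub>H\<^esub> (y \<otimes>\<^bsub>H\<^esub> z)"

text \<open>
  Values outside \<open>carrier H\<close> are unconstrained, so uniqueness of a morphism is to be
  stated among the functions in \<open>extensional (carrier H)\<close>.
\<close>

definition under_vee_hom ::
  "('a, 'm) ring_scheme \<Rightarrow> ('a, 'b, 'n) under_vee_scheme \<Rightarrow> ('a, 'c, 'p) under_vee_scheme
    \<Rightarrow> ('b \<Rightarrow> 'c) set" where
  "under_vee_hom R H K =
    {f \<in> ring_hom H K.
      (\<forall>a \<in> carrier R. \<forall>x \<in> carrier H. f (a \<odot>\<^bsub>H\<^esub> x) = a \<odot>\<^bsub>K\<^esub> f x) \<and>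
      (\<forall>x \<in> carrier H. \<forall>y \<in> carrier H. f (x \<curlyvee>\<^bsub>H\<^esub> y) = f x \<curlyvee>\<^bsub>K\<^esub> f y)}"

text \<open>
  An element of the free module on trees is its coefficient function, of finite support; a tree
  \<open>T\<close> corresponds to \<open>tree_basis R T\<close>. Restricting the sum in \<open>bilinear_ext\<close> to the supports keeps
  its index set finite, as \<open>finsum\<close> requires.
\<close>

definition supp :: "('a, 'm) ring_scheme \<Rightarrow> (pbtree \<Rightarrow> 'a) \<Rightarrow> pbtree set" where
  "supp R f = {T. f T \<noteq> \<zero>\<^bsub>R\<^esub>}"

definition tree_basis :: "('a, 'm) ring_scheme \<Rightarrow> pbtree \<Rightarrow> pbtree \<Rightarrow> 'a" where
  "tree_basis R T = (\<lambda>S. if S = T then \<one>\<^bsub>R\<^esub> else \<zero>\<^bsub>R\<^esub>)"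

definition bilinear_ext ::
  "('a, 'm) ring_scheme \<Rightarrow> (pbtree \<Rightarrow> pbtree \<Rightarrow> pbtree)
    \<Rightarrow> (pbtree \<Rightarrow> 'a) \<Rightarrow> (pbtree \<Rightarrow> 'a) \<Rightarrow> (pbtree \<Rightarrow> 'a)" where
  "bilinear_ext R m f g =
    (\<lambda>T. \<Oplus>\<^bsub>R\<^esub>p \<in> {p \<in> supp R f \<times> supp R g. m (fst p) (snd p) = T}. f (fst p) \<otimes>\<^bsub>R\<^esub> g (snd p))"

definition H_LR :: "('a, 'm) ring_scheme \<Rightarrow> ('a, pbtree \<Rightarrow> 'a) under_vee" where
  "H_LR R =
    \<lparr> carrier = {f. (\<forall>T. f T \<in> carrier R) \<and> finite (supp R f)},
      mult = bilinear_ext R tree_under,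
      one = tree_basis R Triv,
      zero = (\<lambda>T. \<zero>\<^bsub>R\<^esub>),
      add = (\<lambda>f g T. f T \<oplus>\<^bsub>R\<^esub> g T),
      smult = (\<lambda>a f T. a \<otimes>\<^bsub>R\<^esub> f T),
      vee = bilinear_ext R Graft \<rparr>"

end

theory Submission
  imports Defs
begin

text \<open>
  The trees form a basis of \<open>H_LR R\<close>, and every operation in sight is linear in each argument, so
  each identity between elements of \<open>H_LR R\<close>, and each equality of morphisms out of it, only has to
  be tested on trees. This reduction is the induction rule \<open>H_LR_induct\<close>. On trees,
  \<open>(S \<or> T) \<setminus> U = S \<or> (T \<setminus> U)\<close> is the recursion defining the under product, and
  associativity is an induction on the leftmost factor; hence \<open>H_LR R\<close> is a unitary
  \<open>(\<setminus>, \<or>)\<close>-algebra.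

  For freeness, observe that every tree is built from the trivial one by grafting in exactly one
  way. A morphism to \<open>H\<close> has to send the trivial tree to the unit and grafting to \<open>\<or>\<close> of \<open>H\<close>, so its
  values on trees are forced to be those of the recursively defined function \<open>tree_value H\<close>. Its
  linear extension preserves \<open>\<or>\<close> by construction. That it also preserves the product comes
  down to \<open>tree_value_under\<close>: the compatibility axiom in \<open>H\<close> is the same recursion
  that defines the under product on trees.
\<close>

section \<open>The free module on planar binary trees\<close>

lemma supp_tree_basis: "supp R (tree_basis R T) \<subseteq> {T}"
  by (auto simp: supp_def tree_basis_def)

lemma H_LR_simps:
  "f \<in> carrier (H_LR R) \<longleftrightarrow> (\<forall>T. f T \<in> carrier R) \<and> finite (supp R f)"
  "f \<oplus>\<^bsub>H_LR R\<^esub> g = (\<lambda>T. f T \<oplus>\<^bsub>R\<^esub> g T)"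
  "\<zero>\<^bsub>H_LR R\<^esub> = (\<lambda>T. \<zero>\<^bsub>R\<^esub>)"
  "a \<odot>\<^bsub>H_LR R\<^esub> f = (\<lambda>T. a \<otimes>\<^bsub>R\<^esub> f T)"
  "f \<otimes>\<^bsub>H_LR R\<^esub> g = bilinear_ext R tree_under f g"
  "\<one>\<^bsub>H_LR R\<^esub> = tree_basis R Triv"
  "f \<curlyvee>\<^bsub>H_LR R\<^esub> g = bilinear_ext R Graft f g"
  by (simp_all add: H_LR_def)

context cring
begin

lemma tree_basis_closed: "tree_basis R T \<in> carrier (H_LR R)"
  using finite_subset[OF supp_tree_basis] by (auto simp: H_LR_simps tree_basis_def)

lemma supp_add: "supp R (f \<oplus>\<^bsub>H_LR R\<^esub> g) \<subseteq> supp R f \<union> supp R g"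
  by (auto simp: H_LR_simps supp_def)

lemma supp_smult: "a \<in> carrier R \<Longrightarrow> supp R (a \<odot>\<^bsub>H_LR R\<^esub> f) \<subseteq> supp R f"
  by (auto simp: H_LR_simps supp_def)

lemma H_LR_add_closed:
  assumes "f \<in> carrier (H_LR R)" "g \<in> carrier (H_LR R)"
  shows "f \<oplus>\<^bsub>H_LR R\<^esub> g \<in> carrier (H_LR R)"
  using assms finite_subset[OF supp_add[of f g]] by (simp add: H_LR_simps)

lemma H_LR_smult_closed:
  assumes "a \<in> carrier R" "f \<in> carrier (H_LR R)"
  shows "a \<odot>\<^bsub>H_LR R\<^esub> f \<in> carrier (H_LR R)"
  using assms finite_subset[OF supp_smult[of a f]] by (simp add: H_LR_simps)

lemma H_LR_abelian_group: "abelian_group (H_LR R)"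
proof (rule abelian_groupI)
  fix f assume f: "f \<in> carrier (H_LR R)"
  have "(\<ominus> \<one>) \<odot>\<^bsub>H_LR R\<^esub> f \<in> carrier (H_LR R)"
    using f by (intro H_LR_smult_closed) auto
  moreover have "((\<ominus> \<one>) \<odot>\<^bsub>H_LR R\<^esub> f) \<oplus>\<^bsub>H_LR R\<^esub> f = \<zero>\<^bsub>H_LR R\<^esub>"
    using f by (auto simp: H_LR_simps l_minus l_neg)
  ultimately show "\<exists>g\<in>carrier (H_LR R). g \<oplus>\<^bsub>H_LR R\<^esub> f = \<zero>\<^bsub>H_LR R\<^esub>" by blast
qed (simp_all add: H_LR_add_closed, auto simp: H_LR_simps a_ac supp_def)

lemma H_LR_module: "module R (H_LR R)"
  by (rule moduleI)
     (simp_all add: H_LR_smult_closed H_LR_abelian_group is_cring,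
      auto simp: H_LR_simps l_distr r_distr m_assoc)

text \<open>
  Linearity reduces every statement to basis trees. The zero vector is covered by the
  scalar case: it is \<open>\<zero>\<close> times any tree.
\<close>

lemma H_LR_induct [consumes 1, case_names basis add smult]:
  assumes f: "f \<in> carrier (H_LR R)"
    and basis: "\<And>T. P (tree_basis R T)"
    and add: "\<And>f g. \<lbrakk>f \<in> carrier (H_LR R); g \<in> carrier (H_LR R); P f; P g\<rbrakk>
      \<Longrightarrow> P (f \<oplus>\<^bsub>H_LR R\<^esub> g)"
    and smult: "\<And>a f. \<lbrakk>a \<in> carrier R; f \<in> carrier (H_LR R); P f\<rbrakk> \<Longrightarrow> P (a \<odot>\<^bsub>H_LR R\<^esub> f)"
  shows "P f"
proof -
  have "P h" if "finite A" "supp R h \<subseteq> A" "\<forall>T. h T \<in> carrier R" for A h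
    using that
  proof (induction A arbitrary: h rule: finite_induct)
    case empty
    have "h = \<zero> \<odot>\<^bsub>H_LR R\<^esub> tree_basis R Triv"
      using empty by (auto simp: H_LR_simps supp_def tree_basis_def)
    then show ?case
      using smult[of \<zero>] basis tree_basis_closed by simp
  next
    case (insert T A)
    \<comment> \<open>Split off the coefficient of \<open>T\<close>; the remainder is supported on \<open>A\<close>.\<close>
    let ?c = "h T \<odot>\<^bsub>H_LR R\<^esub> tree_basis R T" and ?h = "h(T := \<zero>)"
    have sub: "supp R ?h \<subseteq> A"
      using insert.prems by (auto simp: supp_def)
    then have h: "?h \<in> carrier (H_LR R)"
      using insert finite_subset by (auto simp: H_LR_simps)
    have "P ?h" using insert.prems by (intro insert.IH[OF sub]) simp
    then have "P (?c \<oplus>\<^bsub>H_LR R\<^esub> ?h)"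
      using insert.prems h basis tree_basis_closed
      by (intro add smult H_LR_smult_closed) auto
    moreover have "h = ?c \<oplus>\<^bsub>H_LR R\<^esub> ?h"
      using insert.prems by (auto simp: H_LR_simps tree_basis_def)
    ultimately show ?case by (rule back_subst[where P = P, OF _ sym])
  qed
  from this[of "supp R f" f] show ?thesis using f by (simp add: H_LR_simps)
qed

section \<open>Bilinear extension of operations on trees\<close>

text \<open>
  The index set in the definition of \<open>bilinear_ext\<close> depends on both supports and on the coefficient
  asked for. Padding the sum with zeros up to a fixed rectangle lets the sums for different
  arguments be compared term by term.
\<close>

lemma bilinear_ext_superset:
  assumes "finite A" "finite B" "supp R f \<subseteq> A" "supp R g \<subseteq> B"
    and "\<forall>T. f T \<in> carrier R" "\<forall>T. g T \<in> carrier R"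
  shows "bilinear_ext R m f g T =
    (\<Oplus>p\<in>A \<times> B. if m (fst p) (snd p) = T then f (fst p) \<otimes> g (snd p) else \<zero>)"
  unfolding bilinear_ext_def
proof (rule add.finprod_mono_neutral_cong_left)
  fix p assume "p \<in> A \<times> B - {p \<in> supp R f \<times> supp R g. m (fst p) (snd p) = T}"
  then have "f (fst p) = \<zero> \<or> g (snd p) = \<zero> \<or> m (fst p) (snd p) \<noteq> T"
    by (auto simp: supp_def)
  then show "(if m (fst p) (snd p) = T then f (fst p) \<otimes> g (snd p) else \<zero>) = \<zero>"
    using assms(5,6) by auto
next
  show "{p \<in> supp R f \<times> supp R g. m (fst p) (snd p) = T} \<subseteq> A \<times> B"
    using assms(3,4) by blast
qed (use assms(1,2,5,6) in simp_all)

lemma bilinear_ext_closed: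
  assumes "f \<in> carrier (H_LR R)" "g \<in> carrier (H_LR R)"
  shows "bilinear_ext R m f g \<in> carrier (H_LR R)"
proof -
  have "bilinear_ext R m f g T = \<zero>"
    if "T \<notin> (\<lambda>p. m (fst p) (snd p)) ` (supp R f \<times> supp R g)" for T
  proof -
    have "{p \<in> supp R f \<times> supp R g. m (fst p) (snd p) = T} = {}" using that by (auto simp: image_iff)
    then show ?thesis by (simp only: bilinear_ext_def finsum_empty)
  qed
  then have "supp R (bilinear_ext R m f g) \<subseteq> (\<lambda>p. m (fst p) (snd p)) ` (supp R f \<times> supp R g)"
    unfolding supp_def by blast
  moreover have "bilinear_ext R m f g T \<in> carrier R" for T
    using assms unfolding bilinear_ext_def by (intro finsum_closed) (auto simp: H_LR_simps)
  ultimately show ?thesis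
    using assms finite_subset unfolding H_LR_simps(1) by blast
qed

lemma bilinear_ext_add_left:
  assumes "f \<in> carrier (H_LR R)" "f' \<in> carrier (H_LR R)" "g \<in> carrier (H_LR R)"
  shows "bilinear_ext R m (f \<oplus>\<^bsub>H_LR R\<^esub> f') g =
    bilinear_ext R m f g \<oplus>\<^bsub>H_LR R\<^esub> bilinear_ext R m f' g"
proof
  fix T
  let ?A = "supp R f \<union> supp R f'" and ?B = "supp R g"
  have fin: "finite ?A" "finite ?B"
    and car: "\<forall>T. f T \<in> carrier R" "\<forall>T. f' T \<in> carrier R" "\<forall>T. g T \<in> carrier R"
      "\<forall>T. (f \<oplus>\<^bsub>H_LR R\<^esub> f') T \<in> carrier R"
    using assms by (auto simp: H_LR_simps)
  show "bilinear_ext R m (f \<oplus>\<^bsub>H_LR R\<^esub> f') g T =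
      (bilinear_ext R m f g \<oplus>\<^bsub>H_LR R\<^esub> bilinear_ext R m f' g) T"
    unfolding H_LR_simps(2)[of R "bilinear_ext R m f g"]
    using fin car supp_add[of f f']
    by (subst (1 2 3) bilinear_ext_superset[of ?A ?B])
       (auto simp: H_LR_simps l_distr intro!: add.finprod_cong' simp flip: finsum_addf)
qed

lemma bilinear_ext_add_right:
  assumes "f \<in> carrier (H_LR R)" "g \<in> carrier (H_LR R)" "g' \<in> carrier (H_LR R)"
  shows "bilinear_ext R m f (g \<oplus>\<^bsub>H_LR R\<^esub> g') =
    bilinear_ext R m f g \<oplus>\<^bsub>H_LR R\<^esub> bilinear_ext R m f g'"
proof
  fix T
  let ?A = "supp R f" and ?B = "supp R g \<union> supp R g'"
  have fin: "finite ?A" "finite ?B"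
    and car: "\<forall>T. f T \<in> carrier R" "\<forall>T. g T \<in> carrier R" "\<forall>T. g' T \<in> carrier R"
      "\<forall>T. (g \<oplus>\<^bsub>H_LR R\<^esub> g') T \<in> carrier R"
    using assms by (auto simp: H_LR_simps)
  show "bilinear_ext R m f (g \<oplus>\<^bsub>H_LR R\<^esub> g') T =
      (bilinear_ext R m f g \<oplus>\<^bsub>H_LR R\<^esub> bilinear_ext R m f g') T"
    unfolding H_LR_simps(2)[of R "bilinear_ext R m f g"]
    using fin car supp_add[of g g']
    by (subst (1 2 3) bilinear_ext_superset[of ?A ?B])
       (auto simp: H_LR_simps r_distr intro!: add.finprod_cong' simp flip: finsum_addf)
qed

lemma bilinear_ext_smult_left:
  assumes "a \<in> carrier R" "f \<in> carrier (H_LR R)" "g \<in> carrier (H_LR R)"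
  shows "bilinear_ext R m (a \<odot>\<^bsub>H_LR R\<^esub> f) g = a \<odot>\<^bsub>H_LR R\<^esub> bilinear_ext R m f g"
proof
  fix T
  let ?A = "supp R f" and ?B = "supp R g"
  have fin: "finite ?A" "finite ?B"
    and car: "\<forall>T. f T \<in> carrier R" "\<forall>T. g T \<in> carrier R"
      "\<forall>T. (a \<odot>\<^bsub>H_LR R\<^esub> f) T \<in> carrier R"
    using assms by (auto simp: H_LR_simps)
  show "bilinear_ext R m (a \<odot>\<^bsub>H_LR R\<^esub> f) g T = (a \<odot>\<^bsub>H_LR R\<^esub> bilinear_ext R m f g) T"
    unfolding H_LR_simps(4)[of R a "bilinear_ext R m f g"]
    using fin car supp_smult[of a f] assms(1)
    by (subst (1 2) bilinear_ext_superset[of ?A ?B])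
       (auto simp: H_LR_simps m_assoc finsum_rdistr intro!: add.finprod_cong')
qed

lemma bilinear_ext_smult_right:
  assumes "a \<in> carrier R" "f \<in> carrier (H_LR R)" "g \<in> carrier (H_LR R)"
  shows "bilinear_ext R m f (a \<odot>\<^bsub>H_LR R\<^esub> g) = a \<odot>\<^bsub>H_LR R\<^esub> bilinear_ext R m f g"
proof
  fix T
  let ?A = "supp R f" and ?B = "supp R g"
  have fin: "finite ?A" "finite ?B"
    and car: "\<forall>T. f T \<in> carrier R" "\<forall>T. g T \<in> carrier R"
      "\<forall>T. (a \<odot>\<^bsub>H_LR R\<^esub> g) T \<in> carrier R"
    using assms by (auto simp: H_LR_simps)
  show "bilinear_ext R m f (a \<odot>\<^bsub>H_LR R\<^esub> g) T = (a \<odot>\<^bsub>H_LR R\<^esub> bilinear_ext R m f g) T"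
    unfolding H_LR_simps(4)[of R a "bilinear_ext R m f g"]
    using fin car supp_smult[of a g] assms(1)
    by (subst (1 2) bilinear_ext_superset[of ?A ?B])
       (auto simp: H_LR_simps m_lcomm finsum_rdistr intro!: add.finprod_cong')
qed

lemma bilinear_ext_basis:
  "bilinear_ext R m (tree_basis R S) (tree_basis R T) = tree_basis R (m S T)"
proof
  fix U
  show "bilinear_ext R m (tree_basis R S) (tree_basis R T) U = tree_basis R (m S T) U"
    by (subst bilinear_ext_superset[of "{S}" "{T}"])
       (auto simp: supp_tree_basis[THEN subsetD] tree_basis_def supp_def)
qed

lemmas bilinear_ext_rules =
  bilinear_ext_closed bilinear_ext_basis
  bilinear_ext_add_left bilinear_ext_add_right
  bilinear_ext_smult_left bilinear_ext_smult_right
  tree_basis_closed H_LR_add_closed H_LR_smult_closed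

text \<open>
  An identity \<open>(S \<circ> T) \<bullet> U = S \<circ>' (T \<bullet>' U)\<close> between operations on trees passes to their bilinear
  extensions, both sides being trilinear. Associativity of the under product and its
  compatibility with grafting are both of this shape.
\<close>

lemma bilinear_ext_assoc:
  assumes "\<And>S T U. m (n S T) U = n' S (m' T U)"
    and "f \<in> carrier (H_LR R)" "g \<in> carrier (H_LR R)" "h \<in> carrier (H_LR R)"
  shows "bilinear_ext R m (bilinear_ext R n f g) h =
    bilinear_ext R n' f (bilinear_ext R m' g h)"
  using assms(2)
proof (induction f rule: H_LR_induct)
  case (basis S)
  show ?case
    using assms(3)
  proof (induction g rule: H_LR_induct)
    case (basis T)
    show ?case
      using assms(4) by (induction h rule: H_LR_induct) (simp_all add: bilinear_ext_rules assms(1))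
  qed (simp_all add: bilinear_ext_rules assms(4))
qed (simp_all add: bilinear_ext_rules assms(3,4))

section \<open>The algebra of planar binary trees\<close>

lemma tree_under_Triv: "tree_under S Triv = S"
  by (induction S) simp_all

lemma tree_under_assoc: "tree_under (tree_under S T) U = tree_under S (tree_under T U)"
  by (induction S) simp_all

lemma H_LR_unit:
  assumes "f \<in> carrier (H_LR R)"
  shows "bilinear_ext R tree_under (tree_basis R Triv) f = f"
    and "bilinear_ext R tree_under f (tree_basis R Triv) = f"
  using assms
  by (induction f rule: H_LR_induct) (simp_all add: bilinear_ext_rules tree_under_Triv)

lemma H_LR_ring: "ring (H_LR R)"
proof (rule ringI)
  show "Group.monoid (H_LR R)"
    by (rule monoidI)
       (simp_all add: H_LR_simps(5,6) bilinear_ext_rules H_LR_unit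
         bilinear_ext_assoc[of tree_under tree_under tree_under tree_under, OF tree_under_assoc])
qed (simp_all add: H_LR_abelian_group H_LR_simps(5) bilinear_ext_rules)

lemma H_LR_unitary_under_vee_algebra: "unitary_under_vee_algebra R (H_LR R)"
proof -
  note compat = bilinear_ext_assoc[of tree_under Graft Graft tree_under, OF tree_under.simps(2)]
  show ?thesis
    by (intro unitary_under_vee_algebra.intro unitary_under_vee_algebra_axioms.intro
          H_LR_module H_LR_ring)
       (simp_all add: H_LR_simps(5,7) bilinear_ext_rules compat)
qed

end

section \<open>The universal morphism\<close>

primrec tree_value :: "('a, 'b, 'n) under_vee_scheme \<Rightarrow> pbtree \<Rightarrow> 'b" where
  "tree_value H Triv = \<one>\<^bsub>H\<^esub>"
| "tree_value H (Graft S T) = tree_value H S \<curlyvee>\<^bsub>H\<^esub> tree_value H T"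

definition tree_evaluation ::
  "('a, 'm) ring_scheme \<Rightarrow> ('a, 'b, 'n) under_vee_scheme \<Rightarrow> (pbtree \<Rightarrow> 'a) \<Rightarrow> 'b" where
  "tree_evaluation R H =
    (\<lambda>f \<in> carrier (H_LR R). \<Oplus>\<^bsub>H\<^esub>T \<in> supp R f. f T \<odot>\<^bsub>H\<^esub> tree_value H T)"

context unitary_under_vee_algebra
begin

lemma tree_value_closed: "tree_value H T \<in> carrier H"
  by (induction T) (simp_all add: vee_closed)

text \<open>
  Preservation of the product is automatic once the unit and \<open>\<or>\<close> are preserved: the under product
  satisfies the recursion that the compatibility axiom imposes in \<open>H\<close>.
\<close>

lemma tree_value_under: "tree_value H (tree_under S T) = tree_value H S \<otimes>\<^bsub>H\<^esub> tree_value H T"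
  by (induction S) (simp_all add: tree_value_closed vee_mult)

lemma tree_evaluation_superset:
  assumes "finite A" "supp R f \<subseteq> A" "\<forall>T. f T \<in> carrier R"
  shows "tree_evaluation R H f = (\<Oplus>\<^bsub>H\<^esub>T \<in> A. f T \<odot>\<^bsub>H\<^esub> tree_value H T)"
proof -
  have "f \<in> carrier (H_LR R)"
    using assms finite_subset by (auto simp: H_LR_simps)
  moreover have "(\<Oplus>\<^bsub>H\<^esub>T \<in> supp R f. f T \<odot>\<^bsub>H\<^esub> tree_value H T) =
      (\<Oplus>\<^bsub>H\<^esub>T \<in> A. f T \<odot>\<^bsub>H\<^esub> tree_value H T)"
    using assms
    by (intro add.finprod_mono_neutral_cong_left) (auto simp: supp_def tree_value_closed smult_l_null)
  ultimately show ?thesis by (simp add: tree_evaluation_def)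
qed

lemma tree_evaluation_closed:
  "f \<in> carrier (H_LR R) \<Longrightarrow> tree_evaluation R H f \<in> carrier H"
  by (auto simp: tree_evaluation_def H_LR_simps tree_value_closed intro!: finsum_closed)

lemma tree_evaluation_basis: "tree_evaluation R H (tree_basis R T) = tree_value H T"
  by (subst tree_evaluation_superset[of "{T}"])
     (auto simp: supp_tree_basis[THEN subsetD] tree_basis_def supp_def tree_value_closed)

lemma tree_evaluation_add:
  assumes "f \<in> carrier (H_LR R)" "g \<in> carrier (H_LR R)"
  shows "tree_evaluation R H (f \<oplus>\<^bsub>H_LR R\<^esub> g) = tree_evaluation R H f \<oplus>\<^bsub>H\<^esub> tree_evaluation R H g"
proof -
  let ?A = "supp R f \<union> supp R g"
  have "finite ?A" "\<forall>T. f T \<in> carrier R" "\<forall>T. g T \<in> carrier R"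
    "\<forall>T. (f \<oplus>\<^bsub>H_LR R\<^esub> g) T \<in> carrier R"
    using assms by (auto simp: H_LR_simps)
  then show ?thesis
    using R.supp_add[of f g]
    by (subst (1 2 3) tree_evaluation_superset[of ?A])
       (auto simp: H_LR_simps smult_l_distr tree_value_closed intro!: add.finprod_cong'
         simp flip: finsum_addf)
qed

lemma tree_evaluation_smult:
  assumes "a \<in> carrier R" "f \<in> carrier (H_LR R)"
  shows "tree_evaluation R H (a \<odot>\<^bsub>H_LR R\<^esub> f) = a \<odot>\<^bsub>H\<^esub> tree_evaluation R H f"
proof -
  let ?A = "supp R f"
  have "finite ?A" "\<forall>T. f T \<in> carrier R" "\<forall>T. (a \<odot>\<^bsub>H_LR R\<^esub> f) T \<in> carrier R"
    using assms by (auto simp: H_LR_simps)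
  then show ?thesis
    using R.supp_smult[of a f] assms(1)
    by (subst (1 2) tree_evaluation_superset[of ?A])
       (auto simp: H_LR_simps smult_assoc1 tree_value_closed finsum_smult_ldistr
         intro!: add.finprod_cong')
qed

text \<open>
  The product and \<open>\<or>\<close> are treated at once: \<open>m\<close> is the operation on trees, \<open>n\<close> the one on \<open>H\<close>.
  By bilinearity, intertwining them on trees is enough.
\<close>

lemma tree_evaluation_bilinear:
  assumes op: "\<And>S T. tree_value H (m S T) = n (tree_value H S) (tree_value H T)"
    and add_left: "\<And>x y z. \<lbrakk>x \<in> carrier H; y \<in> carrier H; z \<in> carrier H\<rbrakk> \<Longrightarrow>
      n (x \<oplus>\<^bsub>H\<^esub> y) z = n x z \<oplus>\<^bsub>H\<^esub> n y z"
    and add_right: "\<And>x y z. \<lbrakk>x \<in> carrier H; y \<in> carrier H; z \<in> carrier H\<rbrakk> \<Longrightarrow>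
      n x (y \<oplus>\<^bsub>H\<^esub> z) = n x y \<oplus>\<^bsub>H\<^esub> n x z"
    and smult_left: "\<And>a x y. \<lbrakk>a \<in> carrier R; x \<in> carrier H; y \<in> carrier H\<rbrakk> \<Longrightarrow>
      n (a \<odot>\<^bsub>H\<^esub> x) y = a \<odot>\<^bsub>H\<^esub> n x y"
    and smult_right: "\<And>a x y. \<lbrakk>a \<in> carrier R; x \<in> carrier H; y \<in> carrier H\<rbrakk> \<Longrightarrow>
      n x (a \<odot>\<^bsub>H\<^esub> y) = a \<odot>\<^bsub>H\<^esub> n x y"
    and "f \<in> carrier (H_LR R)" "g \<in> carrier (H_LR R)"
  shows "tree_evaluation R H (bilinear_ext R m f g) =
    n (tree_evaluation R H f) (tree_evaluation R H g)"
proof -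
  note eval = tree_evaluation_basis tree_evaluation_add tree_evaluation_smult
    tree_evaluation_closed tree_value_closed R.bilinear_ext_rules
  show ?thesis
    using assms(6)
  proof (induction f rule: R.H_LR_induct)
    case (basis S)
    show ?case
      using assms(7)
      by (induction g rule: R.H_LR_induct) (simp_all add: eval op add_right smult_right)
  qed (simp_all add: eval assms(7) add_left smult_left)
qed

lemma tree_evaluation_hom: "tree_evaluation R H \<in> under_vee_hom R (H_LR R) H"
proof -
  have "tree_evaluation R H (f \<otimes>\<^bsub>H_LR R\<^esub> g) = tree_evaluation R H f \<otimes>\<^bsub>H\<^esub> tree_evaluation R H g"
    "tree_evaluation R H (f \<curlyvee>\<^bsub>H_LR R\<^esub> g) = tree_evaluation R H f \<curlyvee>\<^bsub>H\<^esub> tree_evaluation R H g"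
    if "f \<in> carrier (H_LR R)" "g \<in> carrier (H_LR R)" for f g
    using that unfolding H_LR_simps(5,7)
    by (auto intro!: tree_evaluation_bilinear simp: tree_value_under l_distr r_distr
        mult_smult_left mult_smult_right vee_add_left vee_add_right vee_smult_left vee_smult_right)
  moreover have "tree_evaluation R H \<one>\<^bsub>H_LR R\<^esub> = \<one>\<^bsub>H\<^esub>"
    by (simp add: H_LR_simps(6) tree_evaluation_basis)
  ultimately show ?thesis
    by (auto simp: under_vee_hom_def intro!: ring_hom_memI
        simp: tree_evaluation_closed tree_evaluation_add tree_evaluation_smult)
qed

text \<open>
  The unit and \<open>\<or>\<close> determine a morphism on trees, since every tree is an iterated grafting of
  trivial trees.
\<close>

lemma under_vee_hom_basis:
  assumes "f \<in> under_vee_hom R (H_LR R) H"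
  shows "f (tree_basis R T) = tree_value H T"
proof (induction T)
  case Triv
  show ?case
    using assms ring_hom_one[of f "H_LR R" H] by (simp add: under_vee_hom_def H_LR_simps(6))
next
  case (Graft S T)
  have "f (tree_basis R (Graft S T)) = f (tree_basis R S \<curlyvee>\<^bsub>H_LR R\<^esub> tree_basis R T)"
    by (simp add: H_LR_simps(7) R.bilinear_ext_basis)
  then show ?case
    using assms Graft by (simp add: under_vee_hom_def R.tree_basis_closed)
qed

lemma under_vee_hom_unique:
  assumes f: "f \<in> under_vee_hom R (H_LR R) H" and g: "g \<in> under_vee_hom R (H_LR R) H"
    and "x \<in> carrier (H_LR R)"
  shows "f x = g x"
  using assms(3)
proof (induction x rule: R.H_LR_induct)
  case (basis T)
  show ?case using f g by (simp add: under_vee_hom_basis)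
next
  case (add x y)
  then show ?case
    using f g ring_hom_add[of f "H_LR R" H x y] ring_hom_add[of g "H_LR R" H x y]
    by (simp add: under_vee_hom_def)
next
  case (smult a x)
  then show ?case using f g by (simp add: under_vee_hom_def)
qed

end

theorem theorem3p7:
  fixes R :: "('a, 'm) ring_scheme"
  assumes "cring R"
  shows "unitary_under_vee_algebra R (H_LR R) \<and>
    (\<forall>H :: ('a, 'h, 'n) under_vee_scheme. unitary_under_vee_algebra R H \<longrightarrow>
      (\<exists>!f. f \<in> under_vee_hom R (H_LR R) H \<and> f \<in> extensional (carrier (H_LR R))))"
proof (intro conjI allI impI)
  show "unitary_under_vee_algebra R (H_LR R)"
    using assms by (rule cring.H_LR_unitary_under_vee_algebra)
next
  fix H :: "('a, 'h, 'n) under_vee_scheme"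
  assume "unitary_under_vee_algebra R H"
  then interpret unitary_under_vee_algebra R H .
  show "\<exists>!f. f \<in> under_vee_hom R (H_LR R) H \<and> f \<in> extensional (carrier (H_LR R))"
  proof (rule ex1I)
    show hom: "tree_evaluation R H \<in> under_vee_hom R (H_LR R) H \<and>
        tree_evaluation R H \<in> extensional (carrier (H_LR R))"
      using tree_evaluation_hom by (simp add: tree_evaluation_def)
    fix f
    assume "f \<in> under_vee_hom R (H_LR R) H \<and> f \<in> extensional (carrier (H_LR R))"
    with hom show "f = tree_evaluation R H"
      by (blast intro: extensionalityI under_vee_hom_unique)
  qed
qed

end
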